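(* Let $((A,\circ),P)$ and $((A^*,\circ_{A^*}),S^* )$ be averaging pre-Lie algebras, where $S:A\to A$ is a linear map with transpose $S^*:A^*\to A^*$. Let $\Delta:A\to A\otimes A$ be defined by $\langle\xi\otimes\eta,\Delta(x)\rangle=\langle\xi\circ_{A^*}\eta,x\rangle$ for all $\xi,\eta\in A^*$, $x\in A$. Then $(A,\circ,\Delta,P,S)$ is an averaging pre-Lie bialgebra if and only if $$\Bigl(((A,\circ),P),\ ((A^*,\circ_{A^*}),S^* ),\ L_\circ^*-R_\circ^*,\ -R_\circ^*,\ L_{\circ_{A^*}}^*-R_{\circ_{A^*}}^*,\ -R_{\circ_{A^*}}^*\Bigr)$$ is a matched pair of averaging pre-Lie algebras.
   Context: All vector spaces are finite-dimensional over a fixed field $\mathbf k$ of characteristic $0$; $\langle\cdot,\cdot\rangle$ is the canonical pairing and $\tau(x\otimes y)=y\otimes x$. A pre-Lie algebra $(A,\circ)$ is a vector space with a bilinear product satisfying $(x\circ y)\circ z-x\circ(y\circ z)=(y\circ x)\circ z-y\circ(x\circ z)$. Write $L_\circ(x)y=L_xy=x\circ y$, $R_\circ(x)y=R_xy=y\circ x$. An averaging operator is a linear $P:A\to A$ with $P(x)\circ P(y)=P(P(x)\circ y)=P(x\circ P(y))$; then $((A,\circ),P)$ is an averaging pre-Lie algebra. For a linear map $\rho:A\to\mathrm{End}(V)$, $\rho^*:A\to\mathrm{End}(V^* )$ is defined by $\langle\rho^*(x)v^*,v\rangle=-\langle v^*,\rho(x)v\rangle$. For a single linear map $S$, $S^*$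 is the transpose $\langle S^*\xi,x\rangle=\langle\xi,S(x)\rangle$. For maps $A^*\to\mathrm{End}(A^* )$ the dual is taken in $\mathrm{End}(A^{**})=\mathrm{End}(A)$. A pre-Lie coalgebra $(A,\Delta)$ satisfies $(\Delta\otimes\mathrm{id})\Delta-(\mathrm{id}\otimes\Delta)\Delta=(\tau\otimes\mathrm{id})\bigl((\Delta\otimes\mathrm{id})\Delta-(\mathrm{id}\otimes\Delta)\Delta\bigr)$. A pre-Lie bialgebra $(A,\circ,\Delta)$ is a pre-Lie algebra and pre-Lie coalgebra such that for all $x,y$: $\Delta(x\circ y-y\circ x)=(L_x\otimes\mathrm{id}+\mathrm{id}\otimes(L_x-R_x))\Delta(y)-(L_y\otimes\mathrm{id}+\mathrm{id}\otimes(L_y-R_y))\Delta(x)$ and $(\mathrm{id}-\tau)\Delta(x\circ y)=(\mathrm{id}-\tau)\bigl[(\mathrm{id}\otimes R_y)\Delta(x)+(L_x\otimes\mathrm{id}+\mathrm{id}\otimes L_x)\Delta(y)\bigr]$. An averaging pre-Lie coalgebra $((A,\Delta),S)$ is a pre-Lie coalgebra with linear $S:A\to A$ such that $(S\otimes S)\Delta(x)=(S\otimes\mathrm{id})\Delta(S(x))=(\mathrm{id}\otimes S)\Delta(S(x))$. An averaging pre-Lie bialgebra is a quintuple $(A,\circ,\Delta,P,S)$ such that $((A,\circ),P)$ is an averaging pre-Lie algebra, $((A,\Delta),S)$ is an averaging pre-Lie coalgebra, $(A,\circ,\Delta)$ is a pre-Lie bialgebra, and for all $x,y\in A$: $P(x)\circ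 S(y)=S(P(x)\circ y)=S(x\circ S(y))$; $S(x)\circ P(y)=S(x\circ P(y))=S(S(x)\circ y)$; $(P\otimes S)\Delta(x)=(\mathrm{id}\otimes S)\Delta(P(x))=(P\otimes\mathrm{id})\Delta(P(x))$; $(S\otimes P)\Delta(x)=(S\otimes\mathrm{id})\Delta(P(x))=(\mathrm{id}\otimes P)\Delta(P(x))$. A representation of $(A,\circ)$ is $(V,\rho,\varphi)$ with linear $\rho,\varphi:A\to\mathrm{End}(V)$ such that $\rho(x\circ y-y\circ x)=\rho(x)\rho(y)-\rho(y)\rho(x)$ and $\varphi(x\circ y)=\rho(x)\varphi(y)-\varphi(y)\rho(x)+\varphi(y)\varphi(x)$. A representation of $((A,\circ),P)$ is $((V,\rho,\varphi),\alpha)$ with $(V,\rho,\varphi)$ a representation of $(A,\circ)$ and $\alpha:V\to V$ linear such that $\rho(P(x))\alpha(v)=\alpha(\rho(P(x))v)=\alpha(\rho(x)\alpha(v))$ and $\varphi(P(x))\alpha(v)=\alpha(\varphi(P(x))v)=\alpha(\varphi(x)\alpha(v))$. A matched pair of averaging pre-Lie algebras is a sextuple $(((A,\circ_A),P_A),((\mathfrak b,\circ_{\mathfrak b}),P_{\mathfrak b}),\rho_A,\varphi_A,\rho_{\mathfrak b},\varphi_{\mathfrak b})$ where the first two entries are averaging pre-Lie algebras, $((\mathfrak b,\rho_A,\varphi_A),P_{\mathfrak b})$ is a representation of $((A,\circ_A),P_A)$, $((A,\rho_{\mathfrak b},\varphi_{\mathfrak b}),P_A)$ is a representation of $((\mathfrak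 b,\circ_{\mathfrak b}),P_{\mathfrak b})$, and for all $x,y\in A$, $a,b\in\mathfrak b$: $\rho_A(x)(a\circ_{\mathfrak b}b)=-\rho_A(\rho_{\mathfrak b}(a)x-\varphi_{\mathfrak b}(a)x)b+(\rho_A(x)a-\varphi_A(x)a)\circ_{\mathfrak b}b+\varphi_A(\varphi_{\mathfrak b}(b)x)a+a\circ_{\mathfrak b}(\rho_A(x)b)$, $\varphi_A(x)(a\circ_{\mathfrak b}b-b\circ_{\mathfrak b}a)=\varphi_A(\rho_{\mathfrak b}(b)x)a-\varphi_A(\rho_{\mathfrak b}(a)x)b+a\circ_{\mathfrak b}(\varphi_A(x)b)-b\circ_{\mathfrak b}(\varphi_A(x)a)$, $\rho_{\mathfrak b}(a)(x\circ_Ay)=-\rho_{\mathfrak b}(\rho_A(x)a-\varphi_A(x)a)y+(\rho_{\mathfrak b}(a)x-\varphi_{\mathfrak b}(a)x)\circ_Ay+\varphi_{\mathfrak b}(\varphi_A(y)a)x+x\circ_A(\rho_{\mathfrak b}(a)y)$, $\varphi_{\mathfrak b}(a)(x\circ_Ay-y\circ_Ax)=\varphi_{\mathfrak b}(\rho_A(y)a)x-\varphi_{\mathfrak b}(\rho_A(x)a)y+x\circ_A(\varphi_{\mathfrak b}(a)y)-y\circ_A(\varphi_{\mathfrak b}(a)x)$. *)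

theory Defs
  imports Complex_Main "HOL-Library.Function_Algebras"
begin

section \<open>Finite-dimensional spaces, linear maps, duals\<close>

text \<open>
  A vector space over the field \<open>'k\<close> is a subspace \<open>V\<close> of an ambient space given by a type
  and a scalar multiplication \<open>s\<close>. Carriers are needed because the dual of a space on the type
  \<open>'a\<close> is only a subspace of \<open>'a \<Rightarrow> 'k\<close>. Functions carry the pointwise addition of
  \<open>Function_Algebras\<close>; this also applies to operator-valued maps, so that
  \<open>(\<rho> - \<phi>) x v = \<rho> x v - \<phi> x v\<close>.
\<close>

definition fd_space :: "('k::field \<Rightarrow> 'v::ab_group_add \<Rightarrow> 'v) \<Rightarrow> 'v set \<Rightarrow> bool" where
  "fd_space s V \<longleftrightarrow> vector_space s \<and> (\<exists>B. finite B \<and> module.span s B = V)"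

definition linear_on ::
  "('k::field \<Rightarrow> 'v::ab_group_add \<Rightarrow> 'v) \<Rightarrow> 'v set \<Rightarrow> ('k \<Rightarrow> 'w::ab_group_add \<Rightarrow> 'w) \<Rightarrow> 'w set
    \<Rightarrow> ('v \<Rightarrow> 'w) \<Rightarrow> bool" where
  "linear_on s V t W f \<longleftrightarrow>
     (\<forall>x\<in>V. f x \<in> W) \<and>
     (\<forall>x\<in>V. \<forall>y\<in>V. f (x + y) = f x + f y) \<and>
     (\<forall>c. \<forall>x\<in>V. f (s c x) = t c (f x))"

text \<open>A linear map \<open>V \<rightarrow> Hom(W, X)\<close>, uncurried.\<close>

definition bilinear_on ::
  "('k::field \<Rightarrow> 'v::ab_group_add \<Rightarrow> 'v) \<Rightarrow> 'v set \<Rightarrow> ('k \<Rightarrow> 'w::ab_group_add \<Rightarrow> 'w) \<Rightarrow> 'w set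
    \<Rightarrow> ('k \<Rightarrow> 'x::ab_group_add \<Rightarrow> 'x) \<Rightarrow> 'x set \<Rightarrow> ('v \<Rightarrow> 'w \<Rightarrow> 'x) \<Rightarrow> bool" where
  "bilinear_on s V t W u X f \<longleftrightarrow>
     (\<forall>x\<in>V. linear_on t W u X (f x)) \<and> (\<forall>w\<in>W. linear_on s V u X (\<lambda>x. f x w))"

definition fscale :: "('k \<Rightarrow> 'v \<Rightarrow> 'v) \<Rightarrow> 'k \<Rightarrow> ('i \<Rightarrow> 'v) \<Rightarrow> 'i \<Rightarrow> 'v" where
  "fscale s c f = (\<lambda>i. s c (f i))"

definition dual :: "('k::field \<Rightarrow> 'a::ab_group_add \<Rightarrow> 'a) \<Rightarrow> ('a \<Rightarrow> 'k) set" where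
  "dual s = {\<xi>. Vector_Spaces.linear s (*) \<xi>}"

abbreviation dual_scale :: "'k::field \<Rightarrow> ('a \<Rightarrow> 'k) \<Rightarrow> 'a \<Rightarrow> 'k" where
  "dual_scale \<equiv> fscale (*)"

definition transpose_map :: "('a \<Rightarrow> 'a) \<Rightarrow> ('a \<Rightarrow> 'k) \<Rightarrow> 'a \<Rightarrow> 'k" where
  "transpose_map S \<xi> = \<xi> \<circ> S"

text \<open>The dual \<open>\<rho>\<^sup>*\<close> of a map \<open>\<rho>\<close> into \<open>End(A)\<close>.\<close>

definition dual_rep :: "('x \<Rightarrow> 'a \<Rightarrow> 'a) \<Rightarrow> 'x \<Rightarrow> ('a \<Rightarrow> 'k::field) \<Rightarrow> 'a \<Rightarrow> 'k" where
  "dual_rep \<rho> x \<xi> = (\<lambda>v. - \<xi> (\<rho> x v))"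

text \<open>The dual \<open>\<rho>\<^sup>*\<close> of a map \<open>\<rho>\<close> into \<open>End(A\<^sup>*)\<close>, with values in \<open>End(A)\<close> through the
  canonical identification \<open>A\<^sup>*\<^sup>* = A\<close>; well-definedness is \<open>bidual_rep_pairing\<close> below.\<close>

definition bidual_rep ::
  "('k::field \<Rightarrow> 'a::ab_group_add \<Rightarrow> 'a) \<Rightarrow> ('x \<Rightarrow> ('a \<Rightarrow> 'k) \<Rightarrow> 'a \<Rightarrow> 'k) \<Rightarrow> 'x \<Rightarrow> 'a \<Rightarrow> 'a" where
  "bidual_rep s \<rho> \<xi> x = (THE y. \<forall>\<eta>\<in>dual s. \<eta> y = - (\<rho> \<xi> \<eta> x))"


section \<open>Tensor powers\<close>

text \<open>
  The tensor \<open>x \<otimes> y\<close> is realized as the bilinear form \<open>(\<xi>, \<eta>) \<mapsto> \<xi>(x) \<eta>(y)\<close> on the dual, and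
  \<open>A \<otimes> A\<close> as the span of these forms. The pairing of \<open>\<xi> \<otimes> \<eta>\<close> with a tensor \<open>t\<close> is thus
  \<open>t \<xi> \<eta>\<close>. Forms are set to zero outside the dual, so that equality of tensors is equality of
  functions. Elements of \<open>A \<otimes> A \<otimes> A\<close> are represented in the same way by trilinear forms, which
  makes the identification of \<open>(A \<otimes> A) \<otimes> A\<close> with \<open>A \<otimes> (A \<otimes> A)\<close> implicit.
\<close>

definition pure :: "('k::field \<Rightarrow> 'a::ab_group_add \<Rightarrow> 'a) \<Rightarrow> 'a \<Rightarrow> 'a \<Rightarrow> ('a \<Rightarrow> 'k) \<Rightarrow> ('a \<Rightarrow> 'k) \<Rightarrow> 'k"
  where "pure s x y = (\<lambda>\<xi> \<eta>. if \<xi> \<in> dual s \<and> \<eta> \<in> dual s then \<xi> x * \<eta> y else 0)"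

definition pure3 ::
  "('k::field \<Rightarrow> 'a::ab_group_add \<Rightarrow> 'a) \<Rightarrow> 'a \<Rightarrow> 'a \<Rightarrow> 'a
    \<Rightarrow> ('a \<Rightarrow> 'k) \<Rightarrow> ('a \<Rightarrow> 'k) \<Rightarrow> ('a \<Rightarrow> 'k) \<Rightarrow> 'k" where
  "pure3 s x y z = (\<lambda>\<xi> \<eta> \<zeta>. if \<xi> \<in> dual s \<and> \<eta> \<in> dual s \<and> \<zeta> \<in> dual s then \<xi> x * \<eta> y * \<zeta> z else 0)"

abbreviation tensor_scale :: "'k::field \<Rightarrow> ('b \<Rightarrow> 'c \<Rightarrow> 'k) \<Rightarrow> 'b \<Rightarrow> 'c \<Rightarrow> 'k" where
  "tensor_scale \<equiv> fscale (fscale (*))"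

definition tensor_sq ::
  "('k::field \<Rightarrow> 'a::ab_group_add \<Rightarrow> 'a) \<Rightarrow> (('a \<Rightarrow> 'k) \<Rightarrow> ('a \<Rightarrow> 'k) \<Rightarrow> 'k) set" where
  "tensor_sq s = module.span tensor_scale {pure s x y | x y. True}"

text \<open>The maps \<open>f \<otimes> g\<close>, \<open>\<tau>\<close>, \<open>\<Delta> \<otimes> id\<close>, \<open>id \<otimes> \<Delta>\<close> and \<open>\<tau> \<otimes> id\<close>; their values on
  pure tensors are established below.\<close>

definition tensor_map ::
  "('k::field \<Rightarrow> 'a::ab_group_add \<Rightarrow> 'a) \<Rightarrow> ('a \<Rightarrow> 'a) \<Rightarrow> ('a \<Rightarrow> 'a)
    \<Rightarrow> (('a \<Rightarrow> 'k) \<Rightarrow> ('a \<Rightarrow> 'k) \<Rightarrow> 'k) \<Rightarrow> ('a \<Rightarrow> 'k) \<Rightarrow> ('a \<Rightarrow> 'k) \<Rightarrow> 'k" where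
  "tensor_map s f g t = (\<lambda>\<xi> \<eta>. if \<xi> \<in> dual s \<and> \<eta> \<in> dual s then t (\<xi> \<circ> f) (\<eta> \<circ> g) else 0)"

definition flip :: "('b \<Rightarrow> 'b \<Rightarrow> 'k) \<Rightarrow> 'b \<Rightarrow> 'b \<Rightarrow> 'k" where
  "flip t = (\<lambda>\<xi> \<eta>. t \<eta> \<xi>)"

definition comult_left ::
  "('k::field \<Rightarrow> 'a::ab_group_add \<Rightarrow> 'a) \<Rightarrow> ('a \<Rightarrow> ('a \<Rightarrow> 'k) \<Rightarrow> ('a \<Rightarrow> 'k) \<Rightarrow> 'k)
    \<Rightarrow> (('a \<Rightarrow> 'k) \<Rightarrow> ('a \<Rightarrow> 'k) \<Rightarrow> 'k)
    \<Rightarrow> ('a \<Rightarrow> 'k) \<Rightarrow> ('a \<Rightarrow> 'k) \<Rightarrow> ('a \<Rightarrow> 'k) \<Rightarrow> 'k" where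
  "comult_left s \<Delta> t = (\<lambda>\<xi> \<eta> \<zeta>. if \<xi> \<in> dual s \<and> \<eta> \<in> dual s \<and> \<zeta> \<in> dual s
     then t (\<lambda>x. \<Delta> x \<xi> \<eta>) \<zeta> else 0)"

definition comult_right ::
  "('k::field \<Rightarrow> 'a::ab_group_add \<Rightarrow> 'a) \<Rightarrow> ('a \<Rightarrow> ('a \<Rightarrow> 'k) \<Rightarrow> ('a \<Rightarrow> 'k) \<Rightarrow> 'k)
    \<Rightarrow> (('a \<Rightarrow> 'k) \<Rightarrow> ('a \<Rightarrow> 'k) \<Rightarrow> 'k)
    \<Rightarrow> ('a \<Rightarrow> 'k) \<Rightarrow> ('a \<Rightarrow> 'k) \<Rightarrow> ('a \<Rightarrow> 'k) \<Rightarrow> 'k" where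
  "comult_right s \<Delta> t = (\<lambda>\<xi> \<eta> \<zeta>. if \<xi> \<in> dual s \<and> \<eta> \<in> dual s \<and> \<zeta> \<in> dual s
     then t \<xi> (\<lambda>x. \<Delta> x \<eta> \<zeta>) else 0)"

definition flip12 :: "('b \<Rightarrow> 'b \<Rightarrow> 'b \<Rightarrow> 'k) \<Rightarrow> 'b \<Rightarrow> 'b \<Rightarrow> 'b \<Rightarrow> 'k" where
  "flip12 T = (\<lambda>\<xi> \<eta> \<zeta>. T \<eta> \<xi> \<zeta>)"


section \<open>Averaging pre-Lie algebras\<close>

definition lmult :: "('a \<Rightarrow> 'a \<Rightarrow> 'a) \<Rightarrow> 'a \<Rightarrow> 'a \<Rightarrow> 'a" where
  "lmult m x y = m x y"

definition rmult :: "('a \<Rightarrow> 'a \<Rightarrow> 'a) \<Rightarrow> 'a \<Rightarrow> 'a \<Rightarrow> 'a" where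
  "rmult m x y = m y x"

definition pre_lie_algebra ::
  "('k::field \<Rightarrow> 'a::ab_group_add \<Rightarrow> 'a) \<Rightarrow> 'a set \<Rightarrow> ('a \<Rightarrow> 'a \<Rightarrow> 'a) \<Rightarrow> bool" where
  "pre_lie_algebra s A m \<longleftrightarrow>
     fd_space s A \<and> bilinear_on s A s A s A m \<and>
     (\<forall>x\<in>A. \<forall>y\<in>A. \<forall>z\<in>A. m (m x y) z - m x (m y z) = m (m y x) z - m y (m x z))"

definition averaging_pre_lie_algebra ::
  "('k::field \<Rightarrow> 'a::ab_group_add \<Rightarrow> 'a) \<Rightarrow> 'a set \<Rightarrow> ('a \<Rightarrow> 'a \<Rightarrow> 'a) \<Rightarrow> ('a \<Rightarrow> 'a) \<Rightarrow> bool" where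
  "averaging_pre_lie_algebra s A m P \<longleftrightarrow>
     pre_lie_algebra s A m \<and> linear_on s A s A P \<and>
     (\<forall>x\<in>A. \<forall>y\<in>A. m (P x) (P y) = P (m (P x) y) \<and> P (m (P x) y) = P (m x (P y)))"

definition pre_lie_rep ::
  "('k::field \<Rightarrow> 'a::ab_group_add \<Rightarrow> 'a) \<Rightarrow> 'a set \<Rightarrow> ('a \<Rightarrow> 'a \<Rightarrow> 'a)
    \<Rightarrow> ('k \<Rightarrow> 'v::ab_group_add \<Rightarrow> 'v) \<Rightarrow> 'v set \<Rightarrow> ('a \<Rightarrow> 'v \<Rightarrow> 'v) \<Rightarrow> ('a \<Rightarrow> 'v \<Rightarrow> 'v) \<Rightarrow> bool" where
  "pre_lie_rep s A m t V \<rho> \<phi> \<longleftrightarrow>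
     pre_lie_algebra s A m \<and> fd_space t V \<and>
     bilinear_on s A t V t V \<rho> \<and> bilinear_on s A t V t V \<phi> \<and>
     (\<forall>x\<in>A. \<forall>y\<in>A. \<forall>v\<in>V.
        \<rho> (m x y - m y x) v = \<rho> x (\<rho> y v) - \<rho> y (\<rho> x v) \<and>
        \<phi> (m x y) v = \<rho> x (\<phi> y v) - \<phi> y (\<rho> x v) + \<phi> y (\<phi> x v))"

definition averaging_pre_lie_rep ::
  "('k::field \<Rightarrow> 'a::ab_group_add \<Rightarrow> 'a) \<Rightarrow> 'a set \<Rightarrow> ('a \<Rightarrow> 'a \<Rightarrow> 'a) \<Rightarrow> ('a \<Rightarrow> 'a)
    \<Rightarrow> ('k \<Rightarrow> 'v::ab_group_add \<Rightarrow> 'v) \<Rightarrow> 'v set \<Rightarrow> ('a \<Rightarrow> 'v \<Rightarrow> 'v) \<Rightarrow> ('a \<Rightarrow> 'v \<Rightarrow> 'v) \<Rightarrow> ('v \<Rightarrow> 'v)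
    \<Rightarrow> bool" where
  "averaging_pre_lie_rep s A m P t V \<rho> \<phi> \<alpha> \<longleftrightarrow>
     averaging_pre_lie_algebra s A m P \<and> pre_lie_rep s A m t V \<rho> \<phi> \<and> linear_on t V t V \<alpha> \<and>
     (\<forall>x\<in>A. \<forall>v\<in>V.
        \<rho> (P x) (\<alpha> v) = \<alpha> (\<rho> (P x) v) \<and> \<alpha> (\<rho> (P x) v) = \<alpha> (\<rho> x (\<alpha> v)) \<and>
        \<phi> (P x) (\<alpha> v) = \<alpha> (\<phi> (P x) v) \<and> \<alpha> (\<phi> (P x) v) = \<alpha> (\<phi> x (\<alpha> v)))"

definition averaging_matched_pair ::
  "('k::field \<Rightarrow> 'a::ab_group_add \<Rightarrow> 'a) \<Rightarrow> 'a set \<Rightarrow> ('a \<Rightarrow> 'a \<Rightarrow> 'a) \<Rightarrow> ('a \<Rightarrow> 'a)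
    \<Rightarrow> ('k \<Rightarrow> 'b::ab_group_add \<Rightarrow> 'b) \<Rightarrow> 'b set \<Rightarrow> ('b \<Rightarrow> 'b \<Rightarrow> 'b) \<Rightarrow> ('b \<Rightarrow> 'b)
    \<Rightarrow> ('a \<Rightarrow> 'b \<Rightarrow> 'b) \<Rightarrow> ('a \<Rightarrow> 'b \<Rightarrow> 'b) \<Rightarrow> ('b \<Rightarrow> 'a \<Rightarrow> 'a) \<Rightarrow> ('b \<Rightarrow> 'a \<Rightarrow> 'a) \<Rightarrow> bool" where
  "averaging_matched_pair sA A mA PA sB B mB PB \<rho>A \<phi>A \<rho>B \<phi>B \<longleftrightarrow>
     averaging_pre_lie_algebra sA A mA PA \<and>
     averaging_pre_lie_algebra sB B mB PB \<and>
     averaging_pre_lie_rep sA A mA PA sB B \<rho>A \<phi>A PB \<and>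
     averaging_pre_lie_rep sB B mB PB sA A \<rho>B \<phi>B PA \<and>
     (\<forall>x\<in>A. \<forall>a\<in>B. \<forall>b\<in>B.
        \<rho>A x (mB a b) =
          - \<rho>A (\<rho>B a x - \<phi>B a x) b + mB (\<rho>A x a - \<phi>A x a) b + \<phi>A (\<phi>B b x) a + mB a (\<rho>A x b)) \<and>
     (\<forall>x\<in>A. \<forall>a\<in>B. \<forall>b\<in>B.
        \<phi>A x (mB a b - mB b a) =
          \<phi>A (\<rho>B b x) a - \<phi>A (\<rho>B a x) b + mB a (\<phi>A x b) - mB b (\<phi>A x a)) \<and>
     (\<forall>a\<in>B. \<forall>x\<in>A. \<forall>y\<in>A.
        \<rho>B a (mA x y) =
          - \<rho>B (\<rho>A x a - \<phi>A x a) y + mA (\<rho>B a x - \<phi>B a x) y + \<phi>B (\<phi>A y a) x + mA x (\<rho>B a y)) \<and>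
     (\<forall>a\<in>B. \<forall>x\<in>A. \<forall>y\<in>A.
        \<phi>B a (mA x y - mA y x) =
          \<phi>B (\<rho>A y a) x - \<phi>B (\<rho>A x a) y + mA x (\<phi>B a y) - mA y (\<phi>B a x))"


section \<open>Averaging pre-Lie bialgebras\<close>

text \<open>Here the underlying space is the whole type \<open>'a\<close>.\<close>

definition pre_lie_coalgebra ::
  "('k::field \<Rightarrow> 'a::ab_group_add \<Rightarrow> 'a) \<Rightarrow> ('a \<Rightarrow> ('a \<Rightarrow> 'k) \<Rightarrow> ('a \<Rightarrow> 'k) \<Rightarrow> 'k) \<Rightarrow> bool" where
  "pre_lie_coalgebra s \<Delta> \<longleftrightarrow>
     fd_space s UNIV \<and> linear_on s UNIV tensor_scale (tensor_sq s) \<Delta> \<and>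
     (\<forall>x. comult_left s \<Delta> (\<Delta> x) - comult_right s \<Delta> (\<Delta> x) =
        flip12 (comult_left s \<Delta> (\<Delta> x) - comult_right s \<Delta> (\<Delta> x)))"

definition averaging_pre_lie_coalgebra ::
  "('k::field \<Rightarrow> 'a::ab_group_add \<Rightarrow> 'a) \<Rightarrow> ('a \<Rightarrow> ('a \<Rightarrow> 'k) \<Rightarrow> ('a \<Rightarrow> 'k) \<Rightarrow> 'k) \<Rightarrow> ('a \<Rightarrow> 'a)
    \<Rightarrow> bool" where
  "averaging_pre_lie_coalgebra s \<Delta> S \<longleftrightarrow>
     pre_lie_coalgebra s \<Delta> \<and> Vector_Spaces.linear s s S \<and>
     (\<forall>x. tensor_map s S S (\<Delta> x) = tensor_map s S id (\<Delta> (S x)) \<and>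
          tensor_map s S id (\<Delta> (S x)) = tensor_map s id S (\<Delta> (S x)))"

definition pre_lie_bialgebra ::
  "('k::field \<Rightarrow> 'a::ab_group_add \<Rightarrow> 'a) \<Rightarrow> ('a \<Rightarrow> 'a \<Rightarrow> 'a)
    \<Rightarrow> ('a \<Rightarrow> ('a \<Rightarrow> 'k) \<Rightarrow> ('a \<Rightarrow> 'k) \<Rightarrow> 'k) \<Rightarrow> bool" where
  "pre_lie_bialgebra s m \<Delta> \<longleftrightarrow>
     pre_lie_algebra s UNIV m \<and> pre_lie_coalgebra s \<Delta> \<and>
     (\<forall>x y. \<Delta> (m x y - m y x) =
        (tensor_map s (lmult m x) id + tensor_map s id (lmult m x - rmult m x)) (\<Delta> y) -
        (tensor_map s (lmult m y) id + tensor_map s id (lmult m y - rmult m y)) (\<Delta> x)) \<and>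
     (\<forall>x y. (id - flip) (\<Delta> (m x y)) =
        (id - flip) (tensor_map s id (rmult m y) (\<Delta> x) +
          (tensor_map s (lmult m x) id + tensor_map s id (lmult m x)) (\<Delta> y)))"

definition averaging_pre_lie_bialgebra ::
  "('k::field \<Rightarrow> 'a::ab_group_add \<Rightarrow> 'a) \<Rightarrow> ('a \<Rightarrow> 'a \<Rightarrow> 'a)
    \<Rightarrow> ('a \<Rightarrow> ('a \<Rightarrow> 'k) \<Rightarrow> ('a \<Rightarrow> 'k) \<Rightarrow> 'k) \<Rightarrow> ('a \<Rightarrow> 'a) \<Rightarrow> ('a \<Rightarrow> 'a) \<Rightarrow> bool" where
  "averaging_pre_lie_bialgebra s m \<Delta> P S \<longleftrightarrow>
     averaging_pre_lie_algebra s UNIV m P \<and>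
     averaging_pre_lie_coalgebra s \<Delta> S \<and>
     pre_lie_bialgebra s m \<Delta> \<and>
     (\<forall>x y. m (P x) (S y) = S (m (P x) y) \<and> S (m (P x) y) = S (m x (S y))) \<and>
     (\<forall>x y. m (S x) (P y) = S (m x (P y)) \<and> S (m x (P y)) = S (m (S x) y)) \<and>
     (\<forall>x. tensor_map s P S (\<Delta> x) = tensor_map s id S (\<Delta> (P x)) \<and>
          tensor_map s id S (\<Delta> (P x)) = tensor_map s P id (\<Delta> (P x))) \<and>
     (\<forall>x. tensor_map s S P (\<Delta> x) = tensor_map s S id (\<Delta> (P x)) \<and>
          tensor_map s S id (\<Delta> (P x)) = tensor_map s id P (\<Delta> (P x)))"


section \<open>Adequacy of the encodings\<close>

lemma vector_space_fscale: "vector_space s \<Longrightarrow> vector_space (fscale s)"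
  by (simp add: vector_space_def fscale_def fun_eq_iff)

lemma vector_space_mult: "vector_space ((*) :: 'k::field \<Rightarrow> _)"
  by (simp add: vector_space_def algebra_simps)

lemma dual_iff:
  assumes "vector_space s"
  shows "\<xi> \<in> dual s \<longleftrightarrow> (\<forall>x y. \<xi> (x + y) = \<xi> x + \<xi> y) \<and> (\<forall>c x. \<xi> (s c x) = c * \<xi> x)"
  using assms by (simp add: dual_def Vector_Spaces.linear_iff vector_space_mult)

lemma linear_on_UNIV:
  assumes "vector_space s" "vector_space t"
  shows "linear_on s UNIV t UNIV f \<longleftrightarrow> Vector_Spaces.linear s t f"
  using assms by (simp add: linear_on_def Vector_Spaces.linear_iff)

lemma sum_fun_app: "(\<Sum>i\<in>I. f i) x = (\<Sum>i\<in>I. f i x)"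
  by (induction I rule: infinite_finite_induct) auto

lemma dual_comp: "Vector_Spaces.linear s s f \<Longrightarrow> \<xi> \<in> dual s \<Longrightarrow> \<xi> \<circ> f \<in> dual s"
  unfolding dual_def using Vector_Spaces.linear_compose by blast

lemma tensor_map_pure:
  assumes "Vector_Spaces.linear s s f" "Vector_Spaces.linear s s g"
  shows "tensor_map s f g (pure s x y) = pure s (f x) (g y)"
  using assms by (auto simp: tensor_map_def pure_def fun_eq_iff dual_comp)

lemma tensor_map_linear: "Vector_Spaces.linear tensor_scale tensor_scale (tensor_map s f g)"
  by (simp add: Vector_Spaces.linear_iff vector_space_fscale vector_space_mult tensor_map_def
      fun_eq_iff fscale_def)

lemma flip_pure: "flip (pure s x y) = pure s y x"
  by (auto simp: flip_def pure_def fun_eq_iff)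

lemma flip12_pure3: "flip12 (pure3 s x y z) = pure3 s y x z"
  by (auto simp: flip12_def pure3_def fun_eq_iff)

lemma comult_left_pure:
  assumes "linear_on s UNIV tensor_scale (tensor_sq s) \<Delta>" "vector_space s"
    and "\<Delta> x = (\<Sum>i\<in>I. pure s (u i) (v i))"
  shows "comult_left s \<Delta> (pure s x y) = (\<Sum>i\<in>I. pure3 s (u i) (v i) y)"
proof -
  have "(\<lambda>z. \<Delta> z \<xi> \<eta>) \<in> dual s" for \<xi> \<eta>
    using assms(1,2) by (simp add: dual_iff linear_on_def fscale_def)
  then show ?thesis
    by (auto simp: comult_left_def pure_def pure3_def fun_eq_iff assms(3) sum_fun_app sum_distrib_right)
qed

lemma comult_right_pure:
  assumes "linear_on s UNIV tensor_scale (tensor_sq s) \<Delta>" "vector_space s"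
    and "\<Delta> y = (\<Sum>i\<in>I. pure s (u i) (v i))"
  shows "comult_right s \<Delta> (pure s x y) = (\<Sum>i\<in>I. pure3 s x (u i) (v i))"
proof -
  have "(\<lambda>z. \<Delta> z \<xi> \<eta>) \<in> dual s" for \<xi> \<eta>
    using assms(1,2) by (simp add: dual_iff linear_on_def fscale_def)
  then show ?thesis
    by (auto simp: comult_right_def pure_def pure3_def fun_eq_iff assms(3) sum_fun_app
        sum_distrib_left mult.assoc)
qed

lemma dual_basis:
  fixes s :: "'k::field \<Rightarrow> 'a::ab_group_add \<Rightarrow> 'a"
  assumes "fd_space s UNIV"
  obtains B e where "finite B" "\<And>b. e b \<in> dual s"
    "\<And>v. (\<Sum>b\<in>B. s (e b v) b) = v" "\<And>\<xi>. \<xi> \<in> dual s \<Longrightarrow> (\<Sum>b\<in>B. dual_scale (\<xi> b) (e b)) = \<xi>"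
proof -
  interpret vector_space s using assms by (simp add: fd_space_def)
  obtain C where C: "finite C" "span C = UNIV" using assms by (auto simp: fd_space_def)
  obtain B where B: "B \<subseteq> C" "independent B" "C \<subseteq> span B"
    using maximal_independent_subset by blast
  have fin: "finite B" using B(1) C(1) finite_subset by blast
  have sp: "span B = UNIV"
    using B(3) C(2) span_mono span_span by (metis top.extremum_uniqueI)
  define e where "e b v = representation B v b" for b v
  have e: "e b \<in> dual s" for b
    unfolding e_def dual_def using linear_representation[OF B(2) sp] by simp
  have 1: "(\<Sum>b\<in>B. s (e b v) b) = v" for v
    unfolding e_def using sum_representation_eq[OF B(2) _ fin] sp by simp
  have 2: "(\<Sum>b\<in>B. dual_scale (\<xi> b) (e b)) = \<xi>" if "\<xi> \<in> dual s" for \<xi>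
  proof
    fix v
    interpret l: Vector_Spaces.linear s "(*)" \<xi> using that by (simp add: dual_def)
    have "\<xi> v = \<xi> (\<Sum>b\<in>B. s (e b v) b)" by (simp add: 1)
    also have "\<dots> = (\<Sum>b\<in>B. e b v * \<xi> b)" by (simp add: l.sum l.scale)
    finally show "(\<Sum>b\<in>B. dual_scale (\<xi> b) (e b)) v = \<xi> v"
      by (simp add: sum_fun_app fscale_def mult.commute)
  qed
  show ?thesis using that fin e 1 2 by blast
qed

lemma subspace_dual:
  fixes s :: "'k::field \<Rightarrow> 'a::ab_group_add \<Rightarrow> 'a"
  assumes s: "vector_space s"
  shows "module.subspace dual_scale (dual s)"
proof -
  interpret d: vector_space "dual_scale :: 'k \<Rightarrow> ('a \<Rightarrow> 'k) \<Rightarrow> _"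
    by (intro vector_space_fscale vector_space_mult)
  show ?thesis
    by (simp add: d.subspace_def dual_iff[OF s] fscale_def algebra_simps)
qed

lemma linear_on_dual_sum:
  fixes s :: "'k::field \<Rightarrow> 'a::ab_group_add \<Rightarrow> 'a"
  assumes s: "vector_space s" and f: "linear_on dual_scale (dual s) dual_scale (dual s) f"
    and "finite F" and e: "\<And>b. e b \<in> dual s"
  shows "f (\<Sum>b\<in>F. dual_scale (c b) (e b)) = (\<Sum>b\<in>F. dual_scale (c b) (f (e b)))"
  using assms(3)
proof (induction F)
  interpret d: vector_space "dual_scale :: 'k \<Rightarrow> ('a \<Rightarrow> 'k) \<Rightarrow> _"
    by (intro vector_space_fscale vector_space_mult)
  note sub = subspace_dual[OF s]
  {
    case empty
    have "f (dual_scale 0 0) = dual_scale 0 (f 0)"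
      using f d.subspace_0[OF sub] unfolding linear_on_def by blast
    then show ?case by (simp only: d.scale_zero_left sum.empty)
  next
    case (insert b F)
    have 1: "(\<Sum>b\<in>F. dual_scale (c b) (e b)) \<in> dual s" "dual_scale (c b) (e b) \<in> dual s"
      using e by (auto intro!: d.subspace_sum[OF sub] d.subspace_scale[OF sub])
    have "f (dual_scale (c b) (e b) + (\<Sum>b\<in>F. dual_scale (c b) (e b))) =
        f (dual_scale (c b) (e b)) + f (\<Sum>b\<in>F. dual_scale (c b) (e b))"
      using f 1 unfolding linear_on_def by blast
    moreover have "f (dual_scale (c b) (e b)) = dual_scale (c b) (f (e b))"
      using f e unfolding linear_on_def by blast
    ultimately show ?case
      by (simp only: sum.insert[OF insert.hyps] insert.IH)
  }
qed

lemma fd_space_dual: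
  fixes s :: "'k::field \<Rightarrow> 'a::ab_group_add \<Rightarrow> 'a"
  assumes "fd_space s UNIV"
  shows "fd_space dual_scale (dual s)"
proof -
  interpret d: vector_space "dual_scale :: 'k \<Rightarrow> ('a \<Rightarrow> 'k) \<Rightarrow> _"
    by (intro vector_space_fscale vector_space_mult)
  have s: "vector_space s" using assms by (simp add: fd_space_def)
  obtain B e where B: "finite B" "\<And>b. e b \<in> dual s" "\<And>v. (\<Sum>b\<in>B. s (e b v) b) = v"
    "\<And>\<xi>. \<xi> \<in> dual s \<Longrightarrow> (\<Sum>b\<in>B. dual_scale (\<xi> b) (e b)) = \<xi>"
    by (rule dual_basis[OF assms]) (rule that)
  have "\<xi> \<in> d.span (e ` B)" if "\<xi> \<in> dual s" for \<xi>
    by (subst B(4)[OF that, symmetric]) (intro d.span_sum d.span_scale d.span_base imageI)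
  moreover have "d.span (e ` B) \<subseteq> dual s"
    by (rule d.span_minimal) (use B(2) subspace_dual[OF s] in auto)
  ultimately show ?thesis
    unfolding fd_space_def using B(1) d.vector_space_axioms by blast
qed

lemma bidual_rep_pairing:
  fixes s :: "'k::field \<Rightarrow> 'a::ab_group_add \<Rightarrow> 'a"
  assumes "fd_space s UNIV" and lin: "linear_on dual_scale (dual s) dual_scale (dual s) (\<rho> \<xi>)"
    and "\<eta> \<in> dual s"
  shows "\<eta> (bidual_rep s \<rho> \<xi> x) = - \<rho> \<xi> \<eta> x"
proof -
  interpret vector_space s using assms by (simp add: fd_space_def)
  obtain B e where B: "finite B" "\<And>b. e b \<in> dual s" "\<And>v. (\<Sum>b\<in>B. s (e b v) b) = v"
    "\<And>\<xi>. \<xi> \<in> dual s \<Longrightarrow> (\<Sum>b\<in>B. dual_scale (\<xi> b) (e b)) = \<xi>"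
    by (rule dual_basis[OF assms(1)]) (rule that)
  define y where "y = (\<Sum>b\<in>B. s (- \<rho> \<xi> (e b) x) b)"
  have y: "\<zeta> y = - \<rho> \<xi> \<zeta> x" if "\<zeta> \<in> dual s" for \<zeta>
  proof -
    interpret l: Vector_Spaces.linear s "(*)" \<zeta> using that by (simp add: dual_def)
    have "\<rho> \<xi> \<zeta> = (\<Sum>b\<in>B. dual_scale (\<zeta> b) (\<rho> \<xi> (e b)))"
      using linear_on_dual_sum[where e = e and c = \<zeta>, OF vector_space_axioms lin B(1,2)]
      by (simp only: B(4)[OF that])
    then have "\<rho> \<xi> \<zeta> x = (\<Sum>b\<in>B. \<zeta> b * \<rho> \<xi> (e b) x)"
      by (simp only: sum_fun_app fscale_def)
    moreover have "\<zeta> y = (\<Sum>b\<in>B. - \<rho> \<xi> (e b) x * \<zeta> b)"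
      by (simp only: y_def l.sum l.scale)
    ultimately show ?thesis by (simp add: sum_negf mult.commute)
  qed
  have uniq: "z = y" if "\<forall>\<zeta>\<in>dual s. \<zeta> z = - \<rho> \<xi> \<zeta> x" for z
  proof -
    have "e b z = e b y" for b by (simp only: y[OF B(2)] bspec[OF that B(2)])
    then have "(\<Sum>b\<in>B. s (e b z) b) = (\<Sum>b\<in>B. s (e b y) b)" by (simp only:)
    then show ?thesis by (simp only: B(3))
  qed
  have "bidual_rep s \<rho> \<xi> x = y"
    unfolding bidual_rep_def
  proof (rule the_equality)
    show "\<forall>\<zeta>\<in>dual s. \<zeta> y = - \<rho> \<xi> \<zeta> x" using y by blast
  qed (rule uniq)
  then show ?thesis by (simp only: y[OF assms(3)])
qed

text \<open>Every product on \<open>A\<^sup>*\<close> has a dual comultiplication.\<close>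

lemma ex_dual_comult:
  fixes s :: "'k::field \<Rightarrow> 'a::ab_group_add \<Rightarrow> 'a"
  assumes fd: "fd_space s UNIV"
    and bil: "bilinear_on dual_scale (dual s) dual_scale (dual s) dual_scale (dual s) m"
  shows "\<exists>\<Delta>. range \<Delta> \<subseteq> tensor_sq s \<and> (\<forall>x. \<forall>\<xi>\<in>dual s. \<forall>\<eta>\<in>dual s. \<Delta> x \<xi> \<eta> = m \<xi> \<eta> x)"
proof -
  interpret vector_space s using assms by (simp add: fd_space_def)
  interpret t: vector_space "tensor_scale :: 'k \<Rightarrow> (('a \<Rightarrow> 'k) \<Rightarrow> ('a \<Rightarrow> 'k) \<Rightarrow> 'k) \<Rightarrow> _"
    by (intro vector_space_fscale vector_space_mult)
  obtain B e where B: "finite B" "\<And>b. e b \<in> dual s" "\<And>v. (\<Sum>b\<in>B. s (e b v) b) = v"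
    "\<And>\<xi>. \<xi> \<in> dual s \<Longrightarrow> (\<Sum>b\<in>B. dual_scale (\<xi> b) (e b)) = \<xi>"
    by (rule dual_basis[OF fd]) (rule that)
  define \<Delta> where "\<Delta> x = (\<Sum>b\<in>B. \<Sum>c\<in>B. tensor_scale (m (e b) (e c) x) (pure s b c))" for x
  have "\<Delta> x \<in> tensor_sq s" for x
    unfolding \<Delta>_def tensor_sq_def by (intro t.span_sum t.span_scale t.span_base) blast
  moreover have "\<Delta> x \<xi> \<eta> = m \<xi> \<eta> x" if "\<xi> \<in> dual s" "\<eta> \<in> dual s" for x \<xi> \<eta>
  proof -
    have lin: "linear_on dual_scale (dual s) dual_scale (dual s) (\<lambda>\<xi>. m \<xi> \<eta>)"
      "linear_on dual_scale (dual s) dual_scale (dual s) (m (e b))" for b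
      using bil that B(2) unfolding bilinear_on_def by blast+
    have 1: "m \<xi> \<eta> = (\<Sum>b\<in>B. dual_scale (\<xi> b) (m (e b) \<eta>))"
      using linear_on_dual_sum[where e = e and c = \<xi>, OF vector_space_axioms lin(1) B(1,2)]
      by (simp only: B(4)[OF that(1)])
    have 2: "m (e b) \<eta> = (\<Sum>c\<in>B. dual_scale (\<eta> c) (m (e b) (e c)))" for b
      using linear_on_dual_sum[where e = e and c = \<eta>, OF vector_space_axioms lin(2) B(1,2)]
      by (simp only: B(4)[OF that(2)])
    have "m \<xi> \<eta> x = (\<Sum>b\<in>B. \<xi> b * (\<Sum>c\<in>B. \<eta> c * m (e b) (e c) x))"
      by (subst 1, subst 2) (simp only: sum_fun_app fscale_def)
    also have "\<dots> = \<Delta> x \<xi> \<eta>"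
      unfolding \<Delta>_def sum_fun_app fscale_def pure_def sum_distrib_left
      by (intro sum.cong refl) (simp add: that)
    finally show ?thesis by (rule sym)
  qed
  ultimately show ?thesis by blast
qed

end

theory Submission
  imports Defs
begin

text \<open>
  Everything is tested against the dual. Pairing the first matched pair equation (evaluated at an
  element of \<open>A\<close>) or the fourth (paired with an element of \<open>A\<^sup>*\<close>) gives exactly the first
  compatibility condition of a pre-Lie bialgebra, paired with \<open>\<xi> \<otimes> \<eta>\<close>; the second and third
  equations both give the second condition. In the same way the operator conditions of the
  representation on \<open>A\<^sup>*\<close> are the mixed conditions on \<open>P\<close>, \<open>S\<close> and the product, and those of the
  representation on \<open>A\<close> are the mixed conditions on \<open>P\<close>, \<open>S\<close> and \<open>\<Delta>\<close>. The coalgebra axioms and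
  the plain representation axioms hold automatically, as duals of the pre-Lie identities.
\<close>

section \<open>Linear algebra on A and its dual\<close>

locale dual_products =
  fixes s :: "'k::field \<Rightarrow> 'a::ab_group_add \<Rightarrow> 'a"
    and m :: "'a \<Rightarrow> 'a \<Rightarrow> 'a"
    and m' :: "('a \<Rightarrow> 'k) \<Rightarrow> ('a \<Rightarrow> 'k) \<Rightarrow> 'a \<Rightarrow> 'k"
    and \<Delta> :: "'a \<Rightarrow> ('a \<Rightarrow> 'k) \<Rightarrow> ('a \<Rightarrow> 'k) \<Rightarrow> 'k"
  assumes fd: "fd_space s UNIV"
    and bilinear_m: "bilinear_on s UNIV s UNIV s UNIV m"
    and bilinear_m': "bilinear_on dual_scale (dual s) dual_scale (dual s) dual_scale (dual s) m'"
    and range_\<Delta>: "range \<Delta> \<subseteq> tensor_sq s"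
    and \<Delta>_pairing: "\<xi> \<in> dual s \<Longrightarrow> \<eta> \<in> dual s \<Longrightarrow> \<Delta> x \<xi> \<eta> = m' \<xi> \<eta> x"
begin

text \<open>The minus sign in \<open>dual_rep\<close> cancels the one in front:
  \<open>\<phi>A x \<xi>\<close> is \<xi> composed with right multiplication by x, and
  \<open>\<rho>A x \<xi>\<close> is \<xi> composed with the negative of the commutator map of x.
  Likewise \<eta> paired with \<open>\<phi>B \<xi> x\<close> is
  \<open>m' \<eta> \<xi> x\<close>.\<close>

abbreviation "\<rho>A \<equiv> dual_rep (lmult m) - dual_rep (rmult m) :: 'a \<Rightarrow> ('a \<Rightarrow> 'k) \<Rightarrow> 'a \<Rightarrow> 'k"
abbreviation "\<phi>A \<equiv> - dual_rep (rmult m) :: 'a \<Rightarrow> ('a \<Rightarrow> 'k) \<Rightarrow> 'a \<Rightarrow> 'k"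
abbreviation "\<rho>B \<equiv> bidual_rep s (lmult m') - bidual_rep s (rmult m')"
abbreviation "\<phi>B \<equiv> - bidual_rep s (rmult m')"

lemma vs: "vector_space s"
  using fd by (simp add: fd_space_def)

lemma dual_apply:
  assumes "\<xi> \<in> dual s"
  shows "\<xi> (x + y) = \<xi> x + \<xi> y" "\<xi> (s c x) = c * \<xi> x" "\<xi> (x - y) = \<xi> x - \<xi> y"
    "\<xi> (- x) = - \<xi> x"
proof -
  interpret l: Vector_Spaces.linear s "(*)" \<xi> using assms by (simp add: dual_def)
  show "\<xi> (x + y) = \<xi> x + \<xi> y" "\<xi> (s c x) = c * \<xi> x" "\<xi> (x - y) = \<xi> x - \<xi> y"
    "\<xi> (- x) = - \<xi> x"
    by (simp_all add: l.add l.scale l.diff l.neg)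
qed

text \<open>Rewrites scalar multiples only where they are evaluated at a point. Unfolding
  \<open>fscale_def\<close> would also destroy \<open>dual_scale c \<xi>\<close> as an argument of
  \<open>m'\<close>, and \<open>m'_scale\<close> would no longer match.\<close>

lemma dual_scale_apply: "dual_scale c \<xi> x = c * \<xi> x" for \<xi> :: "'a \<Rightarrow> 'k"
  by (simp add: fscale_def)

lemma dual_closed:
  "\<xi> \<in> dual s \<Longrightarrow> \<eta> \<in> dual s \<Longrightarrow> \<xi> + \<eta> \<in> dual s"
  "\<xi> \<in> dual s \<Longrightarrow> \<eta> \<in> dual s \<Longrightarrow> \<xi> - \<eta> \<in> dual s"
  "\<xi> \<in> dual s \<Longrightarrow> - \<xi> \<in> dual s"
  "\<xi> \<in> dual s \<Longrightarrow> dual_scale c \<xi> \<in> dual s"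
  by (simp_all add: dual_iff[OF vs] fscale_def algebra_simps)

text \<open>The coordinate functionals of a dual basis already determine a vector. This turns
  equations in A into scalar equations.\<close>

lemma vec_eq_iff: "x = y \<longleftrightarrow> (\<forall>\<eta>\<in>dual s. \<eta> x = \<eta> y)"
proof
  obtain B e where B: "finite B" "\<And>b. e b \<in> dual s" "\<And>v. (\<Sum>b\<in>B. s (e b v) b) = v"
    "\<And>\<xi>. \<xi> \<in> dual s \<Longrightarrow> (\<Sum>b\<in>B. dual_scale (\<xi> b) (e b)) = \<xi>"
    by (rule dual_basis[OF fd]) (rule that)
  assume "\<forall>\<eta>\<in>dual s. \<eta> x = \<eta> y"
  then have "e b x = e b y" for b using B(2) by blast
  then have "(\<Sum>b\<in>B. s (e b x) b) = (\<Sum>b\<in>B. s (e b y) b)" by (simp only:)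
  then show "x = y" by (simp only: B(3))
qed simp

lemma m_linear:
  "m (x + y) z = m x z + m y z" "m z (x + y) = m z x + m z y"
  "m (s c x) z = s c (m x z)" "m z (s c x) = s c (m z x)"
  "m (x - y) z = m x z - m y z" "m z (x - y) = m z x - m z y"
  "m (- x) z = - m x z" "m z (- x) = - m z x"
proof -
  have "Vector_Spaces.linear s s (m z)" "Vector_Spaces.linear s s (\<lambda>x. m x z)"
    using bilinear_m vs by (simp_all add: bilinear_on_def linear_on_UNIV)
  then interpret l: Vector_Spaces.linear s s "m z" + r: Vector_Spaces.linear s s "\<lambda>x. m x z"
    by simp_all
  show "m (x + y) z = m x z + m y z" "m z (x + y) = m z x + m z y"
    "m (s c x) z = s c (m x z)" "m z (s c x) = s c (m z x)"
    "m (x - y) z = m x z - m y z" "m z (x - y) = m z x - m z y"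
    "m (- x) z = - m x z" "m z (- x) = - m z x"
    by (simp_all add: l.add l.scale l.diff l.neg r.add r.scale r.diff r.neg)
qed

lemma comp_mult_dual:
  assumes "\<xi> \<in> dual s"
  shows "\<xi> \<circ> lmult m x \<in> dual s" "\<xi> \<circ> rmult m x \<in> dual s"
  using assms
  by (simp_all add: dual_iff[OF vs] lmult_def rmult_def m_linear)

lemma comp_diff: "\<xi> \<in> dual s \<Longrightarrow> \<xi> \<circ> (f - g) = (\<xi> \<circ> f) - (\<xi> \<circ> g)"
  by (simp add: fun_eq_iff dual_apply)

lemma m'_dual: "\<xi> \<in> dual s \<Longrightarrow> \<eta> \<in> dual s \<Longrightarrow> m' \<xi> \<eta> \<in> dual s"
  using bilinear_m' by (simp add: bilinear_on_def linear_on_def)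

lemma
  assumes "\<zeta> \<in> dual s" "\<xi> \<in> dual s"
  shows m'_add: "\<eta> \<in> dual s \<Longrightarrow> m' (\<xi> + \<eta>) \<zeta> = m' \<xi> \<zeta> + m' \<eta> \<zeta>"
      "\<eta> \<in> dual s \<Longrightarrow> m' \<zeta> (\<xi> + \<eta>) = m' \<zeta> \<xi> + m' \<zeta> \<eta>"
    and m'_scale: "m' (dual_scale c \<xi>) \<zeta> = dual_scale c (m' \<xi> \<zeta>)"
      "m' \<zeta> (dual_scale c \<xi>) = dual_scale c (m' \<zeta> \<xi>)"
  using bilinear_m' assms by (simp_all add: bilinear_on_def linear_on_def)

lemma m'_neg:
  assumes "\<zeta> \<in> dual s" "\<xi> \<in> dual s"
  shows "m' (- \<xi>) \<zeta> = - m' \<xi> \<zeta>" "m' \<zeta> (- \<xi>) = - m' \<zeta> \<xi>"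
proof -
  \<comment> \<open>\<open>linear_on\<close> speaks only of sums and scalar multiples, so negation
    is treated as scaling by -1.\<close>
  have "- \<zeta> = dual_scale (- 1) \<zeta>" for \<zeta> :: "'a \<Rightarrow> 'k" by (simp add: fun_eq_iff fscale_def)
  then show "m' (- \<xi>) \<zeta> = - m' \<xi> \<zeta>" "m' \<zeta> (- \<xi>) = - m' \<zeta> \<xi>"
    using m'_scale[OF assms] by metis+
qed

lemma m'_diff:
  assumes "\<zeta> \<in> dual s" "\<xi> \<in> dual s" "\<eta> \<in> dual s"
  shows "m' (\<xi> - \<eta>) \<zeta> = m' \<xi> \<zeta> - m' \<eta> \<zeta>" "m' \<zeta> (\<xi> - \<eta>) = m' \<zeta> \<xi> - m' \<zeta> \<eta>"
  using m'_add[OF assms(1,2) dual_closed(3)[OF assms(3)]] m'_neg[OF assms(1,3)]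
  by (simp_all only: diff_conv_add_uminus)

section \<open>Pairing the dual operators with functionals\<close>

lemma dual_rep_eq: "dual_rep r x \<xi> = - (\<xi> \<circ> r x)"
  by (simp add: dual_rep_def fun_eq_iff)

lemma bidual_pairing:
  assumes "\<xi> \<in> dual s" "\<eta> \<in> dual s"
  shows "\<eta> (bidual_rep s (lmult m') \<xi> x) = - m' \<xi> \<eta> x"
    "\<eta> (bidual_rep s (rmult m') \<xi> x) = - m' \<eta> \<xi> x"
proof -
  have lin: "linear_on dual_scale (dual s) dual_scale (dual s) (lmult m' \<xi>)"
    "linear_on dual_scale (dual s) dual_scale (dual s) (rmult m' \<xi>)"
    using bilinear_m' assms(1) by (simp_all add: bilinear_on_def linear_on_def lmult_def rmult_def)
  show "\<eta> (bidual_rep s (lmult m') \<xi> x) = - m' \<xi> \<eta> x"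
    using bidual_rep_pairing[where \<rho> = "lmult m'", OF fd lin(1) assms(2)] by (simp add: lmult_def)
  show "\<eta> (bidual_rep s (rmult m') \<xi> x) = - m' \<eta> \<xi> x"
    using bidual_rep_pairing[where \<rho> = "rmult m'", OF fd lin(2) assms(2)] by (simp add: rmult_def)
qed

text \<open>Multiplication by y moves from the vector to the functional: \<eta> composed with it is
  again in the dual, and \<open>bidual_pairing\<close> applies to that functional.\<close>

lemma bidual_pairing_m:
  assumes "\<xi> \<in> dual s" "\<eta> \<in> dual s"
  shows "\<eta> (m y (bidual_rep s (lmult m') \<xi> x)) = - m' \<xi> (\<eta> \<circ> lmult m y) x"
    "\<eta> (m y (bidual_rep s (rmult m') \<xi> x)) = - m' (\<eta> \<circ> lmult m y) \<xi> x"
    "\<eta> (m (bidual_rep s (lmult m') \<xi> x) y) = - m' \<xi> (\<eta> \<circ> rmult m y) x"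
    "\<eta> (m (bidual_rep s (rmult m') \<xi> x) y) = - m' (\<eta> \<circ> rmult m y) \<xi> x"
  using bidual_pairing[OF assms(1) comp_mult_dual(1)[OF assms(2)], of y x]
    bidual_pairing[OF assms(1) comp_mult_dual(2)[OF assms(2)], of y x]
  by (simp_all add: lmult_def rmult_def)

section \<open>The comultiplication dual to \<open>m'\<close>\<close>

text \<open>Pure tensors are 0 there by convention, and vanishing at a fixed pair of arguments
  defines a subspace. Equality of tensors is equality of functions on all arguments, while
  \<open>\<Delta>_pairing\<close> says nothing off the dual.\<close>

lemma tensor_sq_outside:
  assumes "t \<in> tensor_sq s" "\<not> (\<xi> \<in> dual s \<and> \<eta> \<in> dual s)"
  shows "t \<xi> \<eta> = 0"
proof -
  interpret t: vector_space "tensor_scale :: 'k \<Rightarrow> (('a \<Rightarrow> 'k) \<Rightarrow> ('a \<Rightarrow> 'k) \<Rightarrow> 'k) \<Rightarrow> _"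
    by (intro vector_space_fscale vector_space_mult)
  have "t.subspace {t. t \<xi> \<eta> = 0}"
    by (simp add: t.subspace_def fscale_def)
  moreover have "{pure s x y | x y. True} \<subseteq> {t. t \<xi> \<eta> = 0}"
    using assms(2) by (auto simp: pure_def)
  ultimately show ?thesis
    using assms(1) t.span_minimal unfolding tensor_sq_def by blast
qed

lemma \<Delta>_outside: "\<not> (\<xi> \<in> dual s \<and> \<eta> \<in> dual s) \<Longrightarrow> \<Delta> x \<xi> \<eta> = 0"
  using tensor_sq_outside range_\<Delta> by blast

lemma \<Delta>_outside_left: "\<xi> \<notin> dual s \<Longrightarrow> \<Delta> x \<xi> \<eta> = 0"
  and \<Delta>_outside_right: "\<eta> \<notin> dual s \<Longrightarrow> \<Delta> x \<xi> \<eta> = 0"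
  using \<Delta>_outside by blast+

lemma tensor_map_\<Delta>_eq_iff:
  assumes "Vector_Spaces.linear s s f" "Vector_Spaces.linear s s g"
    and "Vector_Spaces.linear s s f'" "Vector_Spaces.linear s s g'"
  shows "tensor_map s f g (\<Delta> x) = tensor_map s f' g' (\<Delta> y) \<longleftrightarrow>
    (\<forall>\<xi>\<in>dual s. \<forall>\<eta>\<in>dual s. m' (\<xi> \<circ> f) (\<eta> \<circ> g) x = m' (\<xi> \<circ> f') (\<eta> \<circ> g') y)"
  using assms by (auto simp: fun_eq_iff tensor_map_def \<Delta>_pairing dual_comp)

text \<open>On the dual, linearity in x holds because \<open>m' \<xi> \<eta>\<close> is itself a
  functional; elsewhere both sides are 0.\<close>

lemma linear_on_\<Delta>: "linear_on s UNIV tensor_scale (tensor_sq s) \<Delta>"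
  unfolding linear_on_def
proof (intro conjI ballI allI)
  show "\<Delta> x \<in> tensor_sq s" for x using range_\<Delta> by blast
  show "\<Delta> (x + y) = \<Delta> x + \<Delta> y" for x y
  proof (intro ext)
    show "\<Delta> (x + y) \<xi> \<eta> = (\<Delta> x + \<Delta> y) \<xi> \<eta>" for \<xi> \<eta>
      by (cases "\<xi> \<in> dual s \<and> \<eta> \<in> dual s")
        (auto simp: \<Delta>_pairing \<Delta>_outside dual_apply m'_dual)
  qed
  show "\<Delta> (s c x) = tensor_scale c (\<Delta> x)" for x c
  proof (intro ext)
    show "\<Delta> (s c x) \<xi> \<eta> = tensor_scale c (\<Delta> x) \<xi> \<eta>" for \<xi> \<eta>
      by (cases "\<xi> \<in> dual s \<and> \<eta> \<in> dual s")
        (auto simp: \<Delta>_pairing \<Delta>_outside dual_apply m'_dual fscale_def)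
  qed
qed

text \<open>Since x \<mapsto> \<open>\<Delta> x \<xi> \<eta>\<close> is the functional
  \<open>m' \<xi> \<eta>\<close>, applying \<open>\<Delta>\<close> twice pairs to an iterated
  product in \<open>m'\<close>. The coalgebra identity is thus the transposed pre-Lie
  identity.\<close>

lemma pre_lie_coalgebra_\<Delta>:
  assumes "pre_lie_algebra dual_scale (dual s) m'"
  shows "pre_lie_coalgebra s \<Delta>"
  unfolding pre_lie_coalgebra_def
proof (intro conjI fd linear_on_\<Delta> allI ext)
  fix x \<xi> \<eta> \<zeta>
  have \<Delta>_fun: "(\<lambda>x. \<Delta> x \<xi> \<eta>) = m' \<xi> \<eta>" if "\<xi> \<in> dual s" "\<eta> \<in> dual s" for \<xi> \<eta>
    using that by (simp add: \<Delta>_pairing)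
  show "(comult_left s \<Delta> (\<Delta> x) - comult_right s \<Delta> (\<Delta> x)) \<xi> \<eta> \<zeta> =
      flip12 (comult_left s \<Delta> (\<Delta> x) - comult_right s \<Delta> (\<Delta> x)) \<xi> \<eta> \<zeta>"
  proof (cases "\<xi> \<in> dual s \<and> \<eta> \<in> dual s \<and> \<zeta> \<in> dual s")
    case True
    then have "m' (m' \<xi> \<eta>) \<zeta> - m' \<xi> (m' \<eta> \<zeta>) = m' (m' \<eta> \<xi>) \<zeta> - m' \<eta> (m' \<xi> \<zeta>)"
      using assms by (simp add: pre_lie_algebra_def)
    then have "m' (m' \<xi> \<eta>) \<zeta> x - m' \<xi> (m' \<eta> \<zeta>) x = m' (m' \<eta> \<xi>) \<zeta> x - m' \<eta> (m' \<xi> \<zeta>) x"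
      by (metis minus_apply)
    then show ?thesis
      using True by (simp add: comult_left_def comult_right_def flip12_def \<Delta>_fun \<Delta>_pairing m'_dual)
  qed (auto simp: comult_left_def comult_right_def flip12_def)
qed

text \<open>The two compatibility conditions of a pre-Lie bialgebra, paired with \<open>\<xi> \<otimes> \<eta>\<close>.\<close>

definition cocycle where
  "cocycle x y \<xi> \<eta> \<longleftrightarrow>
     m' \<xi> \<eta> (m x y) - m' \<xi> \<eta> (m y x) =
       (m' (\<xi> \<circ> lmult m x) \<eta> y + m' \<xi> (\<eta> \<circ> lmult m x) y - m' \<xi> (\<eta> \<circ> rmult m x) y) -
       (m' (\<xi> \<circ> lmult m y) \<eta> x + m' \<xi> (\<eta> \<circ> lmult m y) x - m' \<xi> (\<eta> \<circ> rmult m y) x)"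

definition skew_cocycle where
  "skew_cocycle x y \<xi> \<eta> \<longleftrightarrow>
     m' \<xi> \<eta> (m x y) - m' \<eta> \<xi> (m x y) =
       (m' \<xi> (\<eta> \<circ> rmult m y) x + m' (\<xi> \<circ> lmult m x) \<eta> y + m' \<xi> (\<eta> \<circ> lmult m x) y) -
       (m' \<eta> (\<xi> \<circ> rmult m y) x + m' (\<eta> \<circ> lmult m x) \<xi> y + m' \<eta> (\<xi> \<circ> lmult m x) y)"

text \<open>Moves every operator onto the arguments of \<open>m'\<close>, so that both sides of a
  paired equation become sums of values of \<open>m'\<close> that can be compared term by
  term.\<close>

lemmas pairing_simps = dual_apply m_linear dual_closed comp_mult_dual comp_diff m'_dual m'_add
  m'_scale m'_diff m'_neg dual_rep_eq bidual_pairing bidual_pairing_m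

lemma cocycle_\<Delta>:
  "\<Delta> (m x y - m y x) =
      (tensor_map s (lmult m x) id + tensor_map s id (lmult m x - rmult m x)) (\<Delta> y) -
      (tensor_map s (lmult m y) id + tensor_map s id (lmult m y - rmult m y)) (\<Delta> x)
    \<longleftrightarrow> (\<forall>\<xi>\<in>dual s. \<forall>\<eta>\<in>dual s. cocycle x y \<xi> \<eta>)" (is "?l = ?r \<longleftrightarrow> _")
proof -
  \<comment> \<open>Off the dual both sides are 0, so only arguments in the dual matter.\<close>
  have "?l = ?r \<longleftrightarrow> (\<forall>\<xi>\<in>dual s. \<forall>\<eta>\<in>dual s. ?l \<xi> \<eta> = ?r \<xi> \<eta>)"
    by (auto simp: fun_eq_iff tensor_map_def \<Delta>_outside_left \<Delta>_outside_right)
  then show ?thesis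
    by (simp add: cocycle_def tensor_map_def \<Delta>_pairing pairing_simps algebra_simps)
qed

lemma skew_cocycle_\<Delta>:
  "(id - flip) (\<Delta> (m x y)) =
      (id - flip) (tensor_map s id (rmult m y) (\<Delta> x) +
        (tensor_map s (lmult m x) id + tensor_map s id (lmult m x)) (\<Delta> y))
    \<longleftrightarrow> (\<forall>\<xi>\<in>dual s. \<forall>\<eta>\<in>dual s. skew_cocycle x y \<xi> \<eta>)" (is "?l = ?r \<longleftrightarrow> _")
proof -
  have "?l = ?r \<longleftrightarrow> (\<forall>\<xi>\<in>dual s. \<forall>\<eta>\<in>dual s. ?l \<xi> \<eta> = ?r \<xi> \<eta>)"
    by (auto simp: fun_eq_iff flip_def tensor_map_def \<Delta>_outside_left \<Delta>_outside_right)
  then show ?thesis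
    by (simp add: skew_cocycle_def tensor_map_def flip_def \<Delta>_pairing pairing_simps add.assoc)
qed

section \<open>The four matched pair equations as cocycle conditions\<close>

text \<open>The differences \<open>\<rho>A x a - \<phi>A x a\<close> and
  \<open>\<rho>B a x - \<phi>B a x\<close> are the duals of left multiplication alone, since the two
  right multiplication terms cancel. The point y of evaluation becomes the first argument of
  \<open>cocycle\<close>.\<close>

lemma matched_\<rho>A:
  assumes "a \<in> dual s" "b \<in> dual s"
  shows "\<rho>A x (m' a b) =
      - \<rho>A (\<rho>B a x - \<phi>B a x) b + m' (\<rho>A x a - \<phi>A x a) b + \<phi>A (\<phi>B b x) a + m' a (\<rho>A x b)
    \<longleftrightarrow> (\<forall>y. cocycle y x a b)" (is "?l = ?r \<longleftrightarrow> _")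
proof -
  have "?l y = ?r y \<longleftrightarrow> cocycle y x a b" for y
    using assms
    by (auto simp: cocycle_def pairing_simps lmult_def rmult_def algebra_simps)
  then show ?thesis by (simp only: fun_eq_iff)
qed

lemma matched_\<phi>A:
  assumes "a \<in> dual s" "b \<in> dual s"
  shows "\<phi>A x (m' a b - m' b a) =
      \<phi>A (\<rho>B b x) a - \<phi>A (\<rho>B a x) b + m' a (\<phi>A x b) - m' b (\<phi>A x a)
    \<longleftrightarrow> (\<forall>y. skew_cocycle y x a b)" (is "?l = ?r \<longleftrightarrow> _")
proof -
  have "?l y = ?r y \<longleftrightarrow> skew_cocycle y x a b" for y
    using assms
    by (auto simp: skew_cocycle_def pairing_simps lmult_def rmult_def algebra_simps)
  then show ?thesis by (simp only: fun_eq_iff)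
qed

lemma matched_\<rho>B:
  assumes "a \<in> dual s"
  shows "\<rho>B a (m x y) =
      - \<rho>B (\<rho>A x a - \<phi>A x a) y + m (\<rho>B a x - \<phi>B a x) y + \<phi>B (\<phi>A y a) x + m x (\<rho>B a y)
    \<longleftrightarrow> (\<forall>b\<in>dual s. skew_cocycle x y a b)" (is "?l = ?r \<longleftrightarrow> _")
proof -
  have "b ?l = b ?r \<longleftrightarrow> skew_cocycle x y a b" if "b \<in> dual s" for b
    using assms that
    by (auto simp: skew_cocycle_def pairing_simps algebra_simps)
  then show ?thesis by (simp only: vec_eq_iff[of ?l] cong: ball_cong)
qed

text \<open>The functionals appear as b, a because the dual of right multiplication by a puts the
  test functional b into the left factor of \<open>m'\<close>.\<close>

lemma matched_\<phi>B:
  assumes "a \<in> dual s"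
  shows "\<phi>B a (m x y - m y x) =
      \<phi>B (\<rho>A y a) x - \<phi>B (\<rho>A x a) y + m x (\<phi>B a y) - m y (\<phi>B a x)
    \<longleftrightarrow> (\<forall>b\<in>dual s. cocycle x y b a)" (is "?l = ?r \<longleftrightarrow> _")
proof -
  have "b ?l = b ?r \<longleftrightarrow> cocycle x y b a" if "b \<in> dual s" for b
    using assms that
    by (auto simp: cocycle_def pairing_simps algebra_simps)
  then show ?thesis by (simp only: vec_eq_iff[of ?l] cong: ball_cong)
qed

section \<open>The plain representations on the dual and on A\<close>

lemma pre_lie_rep_A:
  assumes "pre_lie_algebra s UNIV m"
  shows "pre_lie_rep s UNIV m dual_scale (dual s) \<rho>A \<phi>A"
  unfolding pre_lie_rep_def
proof (intro conjI ballI)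
  show "pre_lie_algebra s UNIV m" "fd_space dual_scale (dual s)"
    using assms fd fd_space_dual by blast+
  show "bilinear_on s UNIV dual_scale (dual s) dual_scale (dual s) \<rho>A"
    "bilinear_on s UNIV dual_scale (dual s) dual_scale (dual s) \<phi>A"
    by (auto simp: bilinear_on_def linear_on_def pairing_simps fun_eq_iff fscale_def lmult_def
        rmult_def algebra_simps)
  fix x y \<xi> assume \<xi>: "\<xi> \<in> dual s"
  have pre_lie: "\<xi> (m (m x y) z) - \<xi> (m x (m y z)) = \<xi> (m (m y x) z) - \<xi> (m y (m x z))" for x y z
    using assms by (simp add: pre_lie_algebra_def dual_apply(3)[OF \<xi>, symmetric])
  show "\<rho>A (m x y - m y x) \<xi> = \<rho>A x (\<rho>A y \<xi>) - \<rho>A y (\<rho>A x \<xi>)"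
  proof
    show "\<rho>A (m x y - m y x) \<xi> v = (\<rho>A x (\<rho>A y \<xi>) - \<rho>A y (\<rho>A x \<xi>)) v" for v
      \<comment> \<open>\<open>\<rho>A\<close> is the coadjoint action of the commutator bracket, so
        the claim is the Jacobi identity under \<xi>. It is a combination of the pre-Lie identities
        for the three choices of which pair of x, y, v is interchanged.\<close>
      using pre_lie[of x y v] pre_lie[of x v y] pre_lie[of y v x]
      by (simp add: dual_rep_def lmult_def rmult_def m_linear dual_apply[OF \<xi>]) algebra
  qed
  show "\<phi>A (m x y) \<xi> = \<rho>A x (\<phi>A y \<xi>) - \<phi>A y (\<rho>A x \<xi>) + \<phi>A y (\<phi>A x \<xi>)"
  proof
    show "\<phi>A (m x y) \<xi> v = (\<rho>A x (\<phi>A y \<xi>) - \<phi>A y (\<rho>A x \<xi>) + \<phi>A y (\<phi>A x \<xi>)) v" for v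
      using pre_lie[of x v y]
      by (simp add: dual_rep_def lmult_def rmult_def m_linear dual_apply[OF \<xi>]) algebra
  qed
qed

text \<open>The argument of \<open>pre_lie_rep_A\<close> with \<open>m'\<close> in place of
  \<open>m\<close>. The operators on A are known only through their pairings, so each identity is
  tested on a functional \<eta>, which serves as the third element of the pre-Lie identity.\<close>

lemma pre_lie_rep_B:
  assumes "pre_lie_algebra dual_scale (dual s) m'"
  shows "pre_lie_rep dual_scale (dual s) m' s UNIV \<rho>B \<phi>B"
  unfolding pre_lie_rep_def
proof (intro conjI ballI)
  show "pre_lie_algebra dual_scale (dual s) m'" "fd_space s UNIV"
    using assms fd by blast+
  show "bilinear_on dual_scale (dual s) s UNIV s UNIV \<rho>B"
    unfolding bilinear_on_def linear_on_def
    by (intro conjI ballI allI UNIV_I vec_eq_iff[THEN iffD2],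
        simp_all add: dual_apply dual_closed bidual_pairing m'_dual m'_add m'_scale dual_scale_apply)
      (simp_all add: right_diff_distrib)
  show "bilinear_on dual_scale (dual s) s UNIV s UNIV \<phi>B"
    unfolding bilinear_on_def linear_on_def
    by (intro conjI ballI allI UNIV_I vec_eq_iff[THEN iffD2],
        simp_all add: dual_apply dual_closed bidual_pairing m'_dual m'_add m'_scale dual_scale_apply)
  fix a b x assume a: "a \<in> dual s" and b: "b \<in> dual s"
  have pre_lie: "m' (m' a b) c x - m' a (m' b c) x = m' (m' b a) c x - m' b (m' a c) x"
    if "a \<in> dual s" "b \<in> dual s" "c \<in> dual s" for a b c
  proof -
    have "m' (m' a b) c - m' a (m' b c) = m' (m' b a) c - m' b (m' a c)"
      using assms that by (simp add: pre_lie_algebra_def)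
    from fun_cong[OF this, of x] show ?thesis by simp
  qed
  have "\<eta> (\<rho>B (m' a b - m' b a) x) = \<eta> (\<rho>B a (\<rho>B b x) - \<rho>B b (\<rho>B a x))"
    if \<eta>: "\<eta> \<in> dual s" for \<eta>
    using pre_lie[OF a b \<eta>] pre_lie[OF a \<eta> b] pre_lie[OF b \<eta> a] a b \<eta>
    by (simp add: pairing_simps) algebra
  then show "\<rho>B (m' a b - m' b a) x = \<rho>B a (\<rho>B b x) - \<rho>B b (\<rho>B a x)"
    by (intro vec_eq_iff[THEN iffD2] ballI)
  have "\<eta> (\<phi>B (m' a b) x) = \<eta> (\<rho>B a (\<phi>B b x) - \<phi>B b (\<rho>B a x) + \<phi>B b (\<phi>B a x))"
    if \<eta>: "\<eta> \<in> dual s" for \<eta>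
    using pre_lie[OF a \<eta> b] a b \<eta>
    by (simp add: pairing_simps) algebra
  then show "\<phi>B (m' a b) x = \<rho>B a (\<phi>B b x) - \<phi>B b (\<rho>B a x) + \<phi>B b (\<phi>B a x)"
    by (intro vec_eq_iff[THEN iffD2] ballI)
qed

end

section \<open>Averaging operators and the mixed conditions\<close>

locale dual_averaging = dual_products s m m' \<Delta>
  for s :: "'k::field \<Rightarrow> 'a::ab_group_add \<Rightarrow> 'a" and m m' \<Delta> +
  fixes P S :: "'a \<Rightarrow> 'a"
  assumes linear_S: "Vector_Spaces.linear s s S"
    and averaging_m: "averaging_pre_lie_algebra s UNIV m P"
    and averaging_m': "averaging_pre_lie_algebra dual_scale (dual s) m' (transpose_map S)"
begin

lemma linear_P: "Vector_Spaces.linear s s P"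
  using averaging_m vs by (simp add: averaging_pre_lie_algebra_def linear_on_UNIV)

lemma linear_id: "Vector_Spaces.linear s s id"
  using vs by (simp add: Vector_Spaces.linear_iff)

lemma P_linear: "P (x - y) = P x - P y" "P (- x) = - P x"
proof -
  interpret P: Vector_Spaces.linear s s P by (rule linear_P)
  show "P (x - y) = P x - P y" "P (- x) = - P x"
    by (simp_all add: P.diff P.neg)
qed

text \<open>Composing an argument of \<open>m'\<close> with S applies S to that tensor factor of
  \<open>\<Delta> x\<close>, and composing the product with S replaces x by \<open>S x\<close>. The
  averaging identities of the transpose therefore read as those of the coalgebra.\<close>

lemma averaging_pre_lie_coalgebra_\<Delta>: "averaging_pre_lie_coalgebra s \<Delta> S"
proof -
  have "m' (\<xi> \<circ> S) (\<eta> \<circ> S) x = m' (\<xi> \<circ> S) \<eta> (S x) \<and> m' (\<xi> \<circ> S) \<eta> (S x) = m' \<xi> (\<eta> \<circ> S) (S x)"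
    if "\<xi> \<in> dual s" "\<eta> \<in> dual s" for x \<xi> \<eta>
  proof -
    have "m' (\<xi> \<circ> S) (\<eta> \<circ> S) = m' (\<xi> \<circ> S) \<eta> \<circ> S \<and> m' (\<xi> \<circ> S) \<eta> \<circ> S = m' \<xi> (\<eta> \<circ> S) \<circ> S"
      using averaging_m' that by (simp add: averaging_pre_lie_algebra_def transpose_map_def)
    then show ?thesis by (simp add: fun_eq_iff)
  qed
  then show ?thesis
    using averaging_m' pre_lie_coalgebra_\<Delta> linear_S
    by (auto simp: averaging_pre_lie_coalgebra_def averaging_pre_lie_algebra_def tensor_map_def
        fun_eq_iff \<Delta>_pairing dual_comp)
qed

lemma averaging_rep_A_iff:
  "averaging_pre_lie_rep s UNIV m P dual_scale (dual s) \<rho>A \<phi>A (transpose_map S) \<longleftrightarrow>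
    (\<forall>x y. m (P x) (S y) = S (m (P x) y) \<and> S (m (P x) y) = S (m x (S y))) \<and>
    (\<forall>x y. m (S x) (P y) = S (m x (P y)) \<and> S (m x (P y)) = S (m (S x) y))"
proof -
  let ?T = "transpose_map S :: ('a \<Rightarrow> 'k) \<Rightarrow> 'a \<Rightarrow> 'k"
  \<comment> \<open>The \<open>\<phi>A\<close> equations give the line in which y stands on the left
    of the products; cancelling these terms in the \<open>\<rho>A\<close> equations leaves the line
    in which y stands on the right.\<close>
  have 1: "\<rho>A (P x) (?T \<xi>) = ?T (\<rho>A (P x) \<xi>) \<and> ?T (\<rho>A (P x) \<xi>) = ?T (\<rho>A x (?T \<xi>)) \<and>
      \<phi>A (P x) (?T \<xi>) = ?T (\<phi>A (P x) \<xi>) \<and> ?T (\<phi>A (P x) \<xi>) = ?T (\<phi>A x (?T \<xi>)) \<longleftrightarrow>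
    (\<forall>y. \<xi> (m (P x) (S y)) = \<xi> (S (m (P x) y)) \<and> \<xi> (S (m (P x) y)) = \<xi> (S (m x (S y))) \<and>
      \<xi> (m (S y) (P x)) = \<xi> (S (m y (P x))) \<and> \<xi> (S (m y (P x))) = \<xi> (S (m (S y) x)))" for x \<xi>
    by (auto simp: fun_eq_iff transpose_map_def dual_rep_def lmult_def rmult_def)
  have 2: "averaging_pre_lie_algebra s UNIV m P" "pre_lie_rep s UNIV m dual_scale (dual s) \<rho>A \<phi>A"
      "linear_on dual_scale (dual s) dual_scale (dual s) ?T"
    using averaging_m averaging_m' pre_lie_rep_A by (simp_all add: averaging_pre_lie_algebra_def)
  \<comment> \<open>Brings the quantifier over functionals inside, where \<open>vec_eq_iff\<close>
    places it in the equations in A.\<close>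
  have swap: "(\<forall>\<xi>\<in>dual s. \<forall>y. Q \<xi> y) \<longleftrightarrow> (\<forall>y. \<forall>\<xi>\<in>dual s. Q \<xi> y)"
    for Q :: "('a \<Rightarrow> 'k) \<Rightarrow> 'a \<Rightarrow> bool"
    by blast
  have "averaging_pre_lie_rep s UNIV m P dual_scale (dual s) \<rho>A \<phi>A ?T \<longleftrightarrow>
    (\<forall>x. \<forall>\<xi>\<in>dual s. \<forall>y.
      \<xi> (m (P x) (S y)) = \<xi> (S (m (P x) y)) \<and> \<xi> (S (m (P x) y)) = \<xi> (S (m x (S y))) \<and>
      \<xi> (m (S y) (P x)) = \<xi> (S (m y (P x))) \<and> \<xi> (S (m y (P x))) = \<xi> (S (m (S y) x)))"
    unfolding averaging_pre_lie_rep_def by (simp only: 1 2 ball_UNIV simp_thms)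
  also have "\<dots> \<longleftrightarrow> (\<forall>x y. m (P x) (S y) = S (m (P x) y) \<and> S (m (P x) y) = S (m x (S y)) \<and>
      m (S y) (P x) = S (m y (P x)) \<and> S (m y (P x)) = S (m (S y) x))"
    unfolding vec_eq_iff by (simp only: swap ball_conj_distrib all_conj_distrib)
  also have "\<dots> \<longleftrightarrow> (\<forall>x y. m (P x) (S y) = S (m (P x) y) \<and> S (m (P x) y) = S (m x (S y))) \<and>
      (\<forall>x y. m (S x) (P y) = S (m x (P y)) \<and> S (m x (P y)) = S (m (S x) y))"
    by blast
  finally show ?thesis .
qed

lemma averaging_rep_B_iff:
  "averaging_pre_lie_rep dual_scale (dual s) m' (transpose_map S) s UNIV \<rho>B \<phi>B P \<longleftrightarrow>
    (\<forall>x. tensor_map s P S (\<Delta> x) = tensor_map s id S (\<Delta> (P x)) \<and>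
         tensor_map s id S (\<Delta> (P x)) = tensor_map s P id (\<Delta> (P x))) \<and>
    (\<forall>x. tensor_map s S P (\<Delta> x) = tensor_map s S id (\<Delta> (P x)) \<and>
         tensor_map s S id (\<Delta> (P x)) = tensor_map s id P (\<Delta> (P x)))"
    (is "_ \<longleftrightarrow> ?tensor")
proof -
  let ?T = "transpose_map S :: ('a \<Rightarrow> 'k) \<Rightarrow> 'a \<Rightarrow> 'k"
  \<comment> \<open>The first line comes from \<open>\<phi>B\<close> and pairs the conditions
    starting from P \<otimes> S with \<eta> \<otimes> a. The second is what remains of the
    \<open>\<rho>B\<close> equations and pairs those starting from S \<otimes> P with a \<otimes>
    \<eta>.\<close>
  define E where "E a x \<eta> \<longleftrightarrow>
    m' (\<eta> \<circ> P) (a \<circ> S) x = m' \<eta> (a \<circ> S) (P x) \<and> m' \<eta> (a \<circ> S) (P x) = m' (\<eta> \<circ> P) a (P x) \<and>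
    m' (a \<circ> S) (\<eta> \<circ> P) x = m' (a \<circ> S) \<eta> (P x) \<and> m' (a \<circ> S) \<eta> (P x) = m' a (\<eta> \<circ> P) (P x)" for a x \<eta>
  have 1: "\<rho>B (?T a) (P x) = P (\<rho>B (?T a) x) \<and> P (\<rho>B (?T a) x) = P (\<rho>B a (P x)) \<and>
      \<phi>B (?T a) (P x) = P (\<phi>B (?T a) x) \<and> P (\<phi>B (?T a) x) = P (\<phi>B a (P x)) \<longleftrightarrow>
    (\<forall>\<eta>\<in>dual s. E a x \<eta>)" if a: "a \<in> dual s" for a x
  proof -
    note T = dual_comp[OF linear_S a]
    have "\<eta> (\<rho>B (?T a) (P x)) = \<eta> (P (\<rho>B (?T a) x)) \<and> \<eta> (P (\<rho>B (?T a) x)) = \<eta> (P (\<rho>B a (P x))) \<and>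
      \<eta> (\<phi>B (?T a) (P x)) = \<eta> (P (\<phi>B (?T a) x)) \<and> \<eta> (P (\<phi>B (?T a) x)) = \<eta> (P (\<phi>B a (P x))) \<longleftrightarrow>
      E a x \<eta>" if \<eta>: "\<eta> \<in> dual s" for \<eta>
    proof -
      note \<eta>P = dual_comp[OF linear_P \<eta>]
      show ?thesis
        using bidual_pairing[OF T \<eta>P] bidual_pairing[OF a \<eta>P] bidual_pairing[OF T \<eta>]
        by (auto simp: E_def transpose_map_def P_linear dual_apply[OF \<eta>])
    qed
    then show ?thesis unfolding vec_eq_iff by blast
  qed
  have 2: "?tensor \<longleftrightarrow> (\<forall>x. \<forall>a\<in>dual s. \<forall>\<eta>\<in>dual s. E a x \<eta>)"
    unfolding E_def
    by (simp only: tensor_map_\<Delta>_eq_iff linear_P linear_S linear_id comp_id) blast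
  have 3: "averaging_pre_lie_algebra dual_scale (dual s) m' ?T"
    "pre_lie_rep dual_scale (dual s) m' s UNIV \<rho>B \<phi>B" "linear_on s UNIV s UNIV P"
    using averaging_m averaging_m' pre_lie_rep_B by (simp_all add: averaging_pre_lie_algebra_def)
  have "averaging_pre_lie_rep dual_scale (dual s) m' ?T s UNIV \<rho>B \<phi>B P \<longleftrightarrow>
      (\<forall>a\<in>dual s. \<forall>x\<in>UNIV. \<forall>\<eta>\<in>dual s. E a x \<eta>)"
    unfolding averaging_pre_lie_rep_def by (simp only: 1 3 simp_thms cong: ball_cong)
  then show ?thesis
    unfolding 2 by blast
qed

section \<open>Assembling the equivalence\<close>

lemma bialgebra_iff_matched_pair:
  "averaging_pre_lie_bialgebra s m \<Delta> P S \<longleftrightarrow>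
    averaging_matched_pair s UNIV m P dual_scale (dual s) m' (transpose_map S) \<rho>A \<phi>A \<rho>B \<phi>B"
proof -
  let ?cocycles = "\<forall>x y. \<forall>\<xi>\<in>dual s. \<forall>\<eta>\<in>dual s. cocycle x y \<xi> \<eta> \<and> skew_cocycle x y \<xi> \<eta>"
  have "pre_lie_bialgebra s m \<Delta> \<longleftrightarrow> ?cocycles"
    using averaging_m averaging_pre_lie_coalgebra_\<Delta>
    unfolding pre_lie_bialgebra_def cocycle_\<Delta> skew_cocycle_\<Delta>
    by (auto simp: averaging_pre_lie_algebra_def averaging_pre_lie_coalgebra_def)
  then have "averaging_pre_lie_bialgebra s m \<Delta> P S \<longleftrightarrow>
      ?cocycles \<and> averaging_pre_lie_rep s UNIV m P dual_scale (dual s) \<rho>A \<phi>A (transpose_map S) \<and>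
      averaging_pre_lie_rep dual_scale (dual s) m' (transpose_map S) s UNIV \<rho>B \<phi>B P"
    unfolding averaging_rep_A_iff averaging_rep_B_iff averaging_pre_lie_bialgebra_def
    using averaging_m averaging_pre_lie_coalgebra_\<Delta> by blast
  \<comment> \<open>Each cocycle condition arises from two of the four equations, with its arguments
    permuted; as all arguments are universally quantified, the two versions agree.\<close>
  also have "\<dots> \<longleftrightarrow>
      averaging_matched_pair s UNIV m P dual_scale (dual s) m' (transpose_map S) \<rho>A \<phi>A \<rho>B \<phi>B"
    unfolding averaging_matched_pair_def using averaging_m averaging_m'
    by (simp only: matched_\<rho>A matched_\<phi>A matched_\<rho>B matched_\<phi>B cong: ball_cong) blast
  finally show ?thesis .
qed

end

theorem theorem3p5:
  fixes s :: "'k::field_char_0 \<Rightarrow> 'a::ab_group_add \<Rightarrow> 'a"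
    and m :: "'a \<Rightarrow> 'a \<Rightarrow> 'a"
    and m' :: "('a \<Rightarrow> 'k) \<Rightarrow> ('a \<Rightarrow> 'k) \<Rightarrow> 'a \<Rightarrow> 'k"
    and P S :: "'a \<Rightarrow> 'a"
    and \<Delta> :: "'a \<Rightarrow> ('a \<Rightarrow> 'k) \<Rightarrow> ('a \<Rightarrow> 'k) \<Rightarrow> 'k"
  assumes "Vector_Spaces.linear s s S"
    and "averaging_pre_lie_algebra s UNIV m P"
    and "averaging_pre_lie_algebra dual_scale (dual s) m' (transpose_map S)"
    and "range \<Delta> \<subseteq> tensor_sq s"
    and "\<And>x \<xi> \<eta>. \<xi> \<in> dual s \<Longrightarrow> \<eta> \<in> dual s \<Longrightarrow> \<Delta> x \<xi> \<eta> = m' \<xi> \<eta> x"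
  shows "averaging_pre_lie_bialgebra s m \<Delta> P S \<longleftrightarrow>
    averaging_matched_pair
      s UNIV m P
      dual_scale (dual s) m' (transpose_map S)
      (dual_rep (lmult m) - dual_rep (rmult m)) (- dual_rep (rmult m))
      (bidual_rep s (lmult m') - bidual_rep s (rmult m')) (- bidual_rep s (rmult m'))"
proof -
  have "fd_space s UNIV" "bilinear_on s UNIV s UNIV s UNIV m"
    "bilinear_on dual_scale (dual s) dual_scale (dual s) dual_scale (dual s) m'"
    using assms(2,3) by (simp_all add: averaging_pre_lie_algebra_def pre_lie_algebra_def)
  with assms interpret dual_averaging s m m' \<Delta> P S
    by (simp add: dual_averaging_def dual_products_def dual_averaging_axioms_def)
  show ?thesis by (rule bialgebra_iff_matched_pair)
qed

end
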